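(* Let $\mathcal Q$ be a 2-dimensional space form given by a space form vector $\mathfrak q$, and let $f\in\mathcal C_{\mathcal Q}$. Then $f$ is constrained elastic in $\mathcal Q$ if and only if there exist a vector $\mathfrak a\in\mathbb R^{3,2}\setminus\{0\}$ and a constant $\omega\in\mathbb R\setminus\{0\}$ (independent of the vertex) such that $\kappa_0=\omega\langle\langle\mathfrak f_0,\mathfrak a\rangle\rangle$ at every vertex.
   Context: **Light cone model.** $\mathbb R^{3,2}$ is $\mathbb R^5$ with the inner product $\langle\langle x,y\rangle\rangle=x_1y_1+x_2y_2+x_3y_3-x_4y_4-x_5y_5$, and $\mathfrak p=(0,0,0,0,1)$. Points, oriented circles and oriented lines of $\mathbb R^2\cup\{\infty\}$ correspond to null lines $\mathbb R\mathfrak v$, $\mathfrak v\neq0$, $\langle\langle\mathfrak v,\mathfrak v\rangle\rangle=0$: the point $(x,y)$ to $(x,y,\frac12(1-x^2-y^2),\frac12(1+x^2+y^2),0)$, the oriented circle with center $(x,y)$ and radius $r\in\mathbb{R}\setminus\{0\}$ to $(x,y,\frac12(1-x^2-y^2+r^2),\frac12(1+x^2+y^2-r^2),r)$, the oriented line with unit normal $(x,y)$ and normal distance $d$ to $(x,y,-d,d,1)$, and $\infty$ to $(0,0,1,-1,0)$. Points are the null lines orthogonal to $\mathfrak p$. Two elements are in oriented contact (tangency with orientation, or incidence) iff their inner product vanishes. **Space forms.** A space form $\mathcal Q$ is given by a vector $\mathfrak q\neq0$ with $\langle\langle\mathfrak p,\mathfrak q\rangle\rangle=0$; its sectional curvature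 is $\varepsilon=\kappa_{\mathcal Q}=-\langle\langle\mathfrak q,\mathfrak q\rangle\rangle$. The geodesic curvature of a circle $\mathfrak s$ is $\langle\langle\mathfrak s,\mathfrak q\rangle\rangle/\langle\langle\mathfrak s,\mathfrak p\rangle\rangle$; geodesics are circles with $\langle\langle\mathfrak s,\mathfrak q\rangle\rangle=0$. **Curves.** $\mathcal V=\mathbb Z$ with edges between consecutive integers; $f_{\bar1},f_0,f_1$ denote values at three consecutive vertices, subscripts $\bar10,01$ the edges between them. $\mathcal C_{\mathcal Q}$ is the set of discrete curves $f:\mathcal V\to\mathcal Q$ with constant distance in $\mathcal Q$ between consecutive points, any three consecutive points pairwise distinct, all points on one side of the hyperbolic boundary if $\varepsilon<0$, consecutive points not antipodal if $\varepsilon>0$, together with consistently oriented geodesic edges. The point $f$ is lifted to $\mathfrak f$ with $\langle\langle\mathfrak f,\mathfrak q\rangle\rangle=-1$; the oriented geodesic through $f_0,f_1$ is lifted to the null vector $\mathfrak t_{01}$ with $\langle\langle\mathfrak t_{01},\mathfrak p\rangle\rangle=-1$, $\langle\langle\mathfrak t_{01},\mathfrak q\rangle\rangle=\langle\langle\mathfrak t_{01},\mathfrak f_0\rangle\rangle=\langle\langle\mathfrak t_{01},\mathfrak f_1\rangle\rangle=0$. Consistent orientation means that at each vertex there is a circle $\mathfrak c_0$ (the double-curvature circle) in oriented contact with the geodesic edges at $f_{\bar1}$ and $f_1$, i.e. $\mathfrak c_0=\frac{\kappa_0}{2}\mathfrak f_{\bar1}+\mathfrak t_{\bar10}=\frac{\kappa_0}{2}\mathfrak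 f_1+\mathfrak t_{01}$ with $\kappa_0\in\mathbb R$. The geodesic curvature of $f$ at $f_0$ is this $\kappa_0$, twice the geodesic curvature of $\mathfrak c_0$. The constant $\eta>0$ is defined by $\eta^2=-2\langle\langle\mathfrak f_0,\mathfrak f_1\rangle\rangle$, and $\zeta^2=\eta^2(1-\varepsilon\frac{\eta^2}{4})$. **Constrained elastic.** $f\in\mathcal C_{\mathcal Q}$ is constrained elastic in $\mathcal Q$ if there are constants $\xi,\delta\in\mathbb R$ with $\kappa_{\bar1}+\kappa_1=\dfrac{\xi\kappa_0+\delta}{1+\frac{\zeta^2}{4}\kappa_0^2}$ at every vertex. *)

theory Defs
  imports "HOL-Analysis.Analysis"
begin

definition lie_inner :: "real^5 \<Rightarrow> real^5 \<Rightarrow> real"  (\<open>\<langle>\<langle>_,/ _\<rangle>\<rangle>\<close>) where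
  "\<langle>\<langle>x, y\<rangle>\<rangle> = x$1 * y$1 + x$2 * y$2 + x$3 * y$3 - x$4 * y$4 - x$5 * y$5"

definition point_complex :: "real^5"  (\<open>\<pp>\<close>) where
  "\<pp> = axis 5 1"

definition space_form_vector :: "real^5 \<Rightarrow> bool" where
  "space_form_vector q \<longleftrightarrow> q \<noteq> 0 \<and> \<langle>\<langle>\<pp>, q\<rangle>\<rangle> = 0"

definition sectional_curvature :: "real^5 \<Rightarrow> real" where
  "sectional_curvature q = - \<langle>\<langle>q, q\<rangle>\<rangle>"

text \<open>
  Every null line orthogonal to \<open>\<pp>\<close> but not to \<open>q\<close> contains exactly one vector of the
  following set, so points of the space form are identified with their normalised lifts.
  For negative curvature the set has two components, one on either side of the boundary
  at infinity, which consists of the null lines orthogonal to both \<open>\<pp>\<close> and \<open>q\<close>.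
\<close>
definition space_form :: "real^5 \<Rightarrow> (real^5) set" where
  "space_form q = {x. \<langle>\<langle>x, x\<rangle>\<rangle> = 0 \<and> \<langle>\<langle>x, \<pp>\<rangle>\<rangle> = 0 \<and> \<langle>\<langle>x, q\<rangle>\<rangle> = -1}"

text \<open>
  The induced metric on \<open>space_form q\<close> has constant curvature \<open>\<epsilon>\<close>.  For \<open>\<epsilon> \<noteq> 0\<close> it is the
  quadric of radius \<open>1 / sqrt \<bar>\<epsilon>\<bar>\<close> with centre \<open>q / \<epsilon>\<close>, and
  \<open>\<epsilon> * \<langle>\<langle>x - q/\<epsilon>, y - q/\<epsilon>\<rangle>\<rangle> = 1 + \<epsilon> * \<langle>\<langle>x, y\<rangle>\<rangle>\<close>.  In the hyperbolic case the formula is the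
  distance only for two points on the same side of the boundary.
\<close>
definition space_form_dist :: "real^5 \<Rightarrow> real^5 \<Rightarrow> real^5 \<Rightarrow> real" where
  "space_form_dist q x y =
    (let \<epsilon> = sectional_curvature q in
      if \<epsilon> > 0 then arccos (1 + \<epsilon> * \<langle>\<langle>x, y\<rangle>\<rangle>) / sqrt \<epsilon>
      else if \<epsilon> = 0 then sqrt (- 2 * \<langle>\<langle>x, y\<rangle>\<rangle>)
      else arcosh (1 + \<epsilon> * \<langle>\<langle>x, y\<rangle>\<rangle>) / sqrt (- \<epsilon>))"

text \<open>
  Point reflection of the sphere in its centre \<open>q / \<epsilon>\<close>; meaningful for \<open>\<epsilon> > 0\<close> only.
\<close>
definition antipodal :: "real^5 \<Rightarrow> real^5 \<Rightarrow> real^5 \<Rightarrow> bool" where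
  "antipodal q x y \<longleftrightarrow>
    (let m = (1 / sectional_curvature q) *\<^sub>R q in x - m = - (y - m))"

text \<open>
  Scaling a point to fourth coordinate 1 puts it on the conformal sphere
  \<open>x\<^sub>1\<^sup>2 + x\<^sub>2\<^sup>2 + x\<^sub>3\<^sup>2 = 1\<close>, on which the boundary is the plane section
  \<open>\<langle>\<langle>x, q\<rangle>\<rangle> = 0\<close>.  A nonzero null vector orthogonal to \<open>\<pp>\<close> has nonzero fourth coordinate.
\<close>
definition boundary_side :: "real^5 \<Rightarrow> real^5 \<Rightarrow> real" where
  "boundary_side q x = sgn \<langle>\<langle>(1 / x$4) *\<^sub>R x, q\<rangle>\<rangle>"

definition geodesic_lift :: "real^5 \<Rightarrow> real^5 \<Rightarrow> real^5 \<Rightarrow> real^5 \<Rightarrow> bool" where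
  "geodesic_lift q x y s \<longleftrightarrow>
    \<langle>\<langle>s, s\<rangle>\<rangle> = 0 \<and> \<langle>\<langle>s, \<pp>\<rangle>\<rangle> = -1 \<and> \<langle>\<langle>s, q\<rangle>\<rangle> = 0 \<and> \<langle>\<langle>s, x\<rangle>\<rangle> = 0 \<and> \<langle>\<langle>s, y\<rangle>\<rangle> = 0"

text \<open>
  A curve is given by its vertices \<open>f\<close> and its oriented edges \<open>t\<close>, where \<open>t i\<close> is the edge
  joining \<open>f i\<close> and \<open>f (i + 1)\<close>.
\<close>
definition double_curvature_circle ::
    "(int \<Rightarrow> real^5) \<Rightarrow> (int \<Rightarrow> real^5) \<Rightarrow> int \<Rightarrow> real^5 \<Rightarrow> real \<Rightarrow> bool" where
  "double_curvature_circle f t i c \<kappa> \<longleftrightarrow>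
    c = (\<kappa> / 2) *\<^sub>R f (i - 1) + t (i - 1) \<and> c = (\<kappa> / 2) *\<^sub>R f (i + 1) + t i"

definition discrete_curves :: "real^5 \<Rightarrow> ((int \<Rightarrow> real^5) \<times> (int \<Rightarrow> real^5)) set" where
  "discrete_curves q = {(f, t).
    (\<forall>i. f i \<in> space_form q) \<and>
    (\<exists>d. \<forall>i. space_form_dist q (f i) (f (i + 1)) = d) \<and>
    (\<forall>i. f (i - 1) \<noteq> f i \<and> f i \<noteq> f (i + 1) \<and> f (i - 1) \<noteq> f (i + 1)) \<and>
    (sectional_curvature q < 0 \<longrightarrow> (\<forall>i j. boundary_side q (f i) = boundary_side q (f j))) \<and>
    (sectional_curvature q > 0 \<longrightarrow> (\<forall>i. \<not> antipodal q (f i) (f (i + 1)))) \<and>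
    (\<forall>i. geodesic_lift q (f i) (f (i + 1)) (t i)) \<and>
    (\<forall>i. \<exists>c \<kappa>. double_curvature_circle f t i c \<kappa>)}"

text \<open>
  Uniqueness of the curvature needs only that \<open>f (i - 1) \<noteq> f (i + 1)\<close>.
\<close>
definition curvature :: "(int \<Rightarrow> real^5) \<Rightarrow> (int \<Rightarrow> real^5) \<Rightarrow> int \<Rightarrow> real" where
  "curvature f t i = (THE \<kappa>. \<exists>c. double_curvature_circle f t i c \<kappa>)"

text \<open>
  On \<open>discrete_curves q\<close> all edges have the same length, so any edge may be used here.
\<close>
definition eta :: "(int \<Rightarrow> real^5) \<Rightarrow> real" where
  "eta f = sqrt (- 2 * \<langle>\<langle>f 0, f 1\<rangle>\<rangle>)"

definition zeta_squared :: "real^5 \<Rightarrow> (int \<Rightarrow> real^5) \<Rightarrow> real" where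
  "zeta_squared q f = (eta f)\<^sup>2 * (1 - sectional_curvature q * (eta f)\<^sup>2 / 4)"

definition constrained_elastic ::
    "real^5 \<Rightarrow> (int \<Rightarrow> real^5) \<Rightarrow> (int \<Rightarrow> real^5) \<Rightarrow> bool" where
  "constrained_elastic q f t \<longleftrightarrow>
    (\<exists>\<xi> \<delta> :: real. \<forall>i.
      curvature f t (i - 1) + curvature f t (i + 1) =
        (\<xi> * curvature f t i + \<delta>) / (1 + zeta_squared q f / 4 * (curvature f t i)\<^sup>2))"

end

theory Submission
  imports Defs
begin

text \<open>
  Let \<open>n i = t i - \<pp>\<close> be the unit normal of the edge \<open>i\<close> in the orthogonal complement of \<open>\<pp>\<close>.
  The double-curvature circle gives
  \<open>n i - n (i - 1) = (\<kappa> i / 2) *\<^sub>R (f (i - 1) - f (i + 1))\<close>, and at each vertex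
  \<open>f (i - 1) + f (i + 1) =
    (2 - \<epsilon> \<eta>\<^sup>2) *\<^sub>R f i + \<eta>\<^sup>2 *\<^sub>R q + (\<kappa> i \<zeta>\<^sup>2 / 2) *\<^sub>R (n (i - 1) + n i)\<close>.
  If \<open>\<kappa> i = \<langle>\<langle>f i, b\<rangle>\<rangle>\<close>, pairing the first identity with \<open>b\<close> shows that
  \<open>C = \<langle>\<langle>n i, b\<rangle>\<rangle> + \<kappa> i \<kappa> (i + 1) / 2\<close> does not depend on \<open>i\<close>, and the second one becomes the
  elastic recurrence with \<open>\<xi> = 2 - \<epsilon> \<eta>\<^sup>2 + C \<zeta>\<^sup>2\<close> and \<open>\<delta> = \<eta>\<^sup>2 \<langle>\<langle>q, b\<rangle>\<rangle>\<close>.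
  Conversely, these values prescribe the products of the sought vector with \<open>q\<close>, \<open>f 0\<close>, \<open>f 1\<close> and
  \<open>n 0\<close>, which are linearly independent because \<open>\<zeta>\<^sup>2 > 0\<close>; both identities then propagate
  \<open>\<langle>\<langle>f i, a\<rangle>\<rangle> = \<kappa> i\<close> along the curve. Adding \<open>\<pp>\<close> to \<open>a\<close> makes it nonzero without changing any
  of these products.
\<close>

section \<open>Coordinates, bilinearity and orthogonal families in \<open>\<real>^5\<close>\<close>

lemma exhaust_5: "x = 1 \<or> x = 2 \<or> x = 3 \<or> x = 4 \<or> x = (5::5)"
proof (induct x)
  case (of_int z)
  then have "z = 0 \<or> z = 1 \<or> z = 2 \<or> z = 3 \<or> z = 4" by simp arith
  then show ?case by auto
qed

lemma forall_5: "(\<forall>i::5. P i) \<longleftrightarrow> P 1 \<and> P 2 \<and> P 3 \<and> P 4 \<and> P 5"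
  by (metis exhaust_5)

lemma vec_eq_iff_5:
  fixes x y :: "real^5"
  shows "x = y \<longleftrightarrow> x$1 = y$1 \<and> x$2 = y$2 \<and> x$3 = y$3 \<and> x$4 = y$4 \<and> x$5 = y$5"
  by (simp add: vec_eq_iff forall_5)

lemma lie_inner_commute: "\<langle>\<langle>x, y\<rangle>\<rangle> = \<langle>\<langle>y, x\<rangle>\<rangle>"
  by (simp add: lie_inner_def mult.commute)

lemma lie_inner_linear [simp]:
  "\<langle>\<langle>x + y, z\<rangle>\<rangle> = \<langle>\<langle>x, z\<rangle>\<rangle> + \<langle>\<langle>y, z\<rangle>\<rangle>"
  "\<langle>\<langle>z, x + y\<rangle>\<rangle> = \<langle>\<langle>z, x\<rangle>\<rangle> + \<langle>\<langle>z, y\<rangle>\<rangle>"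
  "\<langle>\<langle>x - y, z\<rangle>\<rangle> = \<langle>\<langle>x, z\<rangle>\<rangle> - \<langle>\<langle>y, z\<rangle>\<rangle>"
  "\<langle>\<langle>z, x - y\<rangle>\<rangle> = \<langle>\<langle>z, x\<rangle>\<rangle> - \<langle>\<langle>z, y\<rangle>\<rangle>"
  "\<langle>\<langle>c *\<^sub>R x, z\<rangle>\<rangle> = c * \<langle>\<langle>x, z\<rangle>\<rangle>"
  "\<langle>\<langle>z, c *\<^sub>R x\<rangle>\<rangle> = c * \<langle>\<langle>z, x\<rangle>\<rangle>"
  "\<langle>\<langle>0, z\<rangle>\<rangle> = 0"
  "\<langle>\<langle>z, 0\<rangle>\<rangle> = 0"
  by (simp_all add: lie_inner_def algebra_simps)

lemma lie_inner_point_complex: "\<langle>\<langle>x, \<pp>\<rangle>\<rangle> = - x$5"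
  by (simp add: lie_inner_def point_complex_def axis_def)

lemma lie_inner_point_complex_self [simp]: "\<langle>\<langle>\<pp>, \<pp>\<rangle>\<rangle> = -1"
  by (simp add: lie_inner_def point_complex_def axis_def)

text \<open>A member in the span of the others would be orthogonal to itself. For an indefinite
  form, excluding null members takes the place of definiteness.\<close>

lemma orthogonal_family_independent:
  assumes orth: "pairwise (\<lambda>x y. \<langle>\<langle>x, y\<rangle>\<rangle> = 0) S" and "\<And>x. x \<in> S \<Longrightarrow> \<langle>\<langle>x, x\<rangle>\<rangle> \<noteq> 0"
  shows "independent S"
proof
  assume "dependent S"
  then obtain a where a: "a \<in> S" "a \<in> span (S - {a})"
    by (auto simp: dependent_def)
  have "\<langle>\<langle>a, b\<rangle>\<rangle> = 0" if "b \<in> span (S - {a})" for b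
    using that
  proof (induction rule: span_induct)
    case base
    show ?case by (simp add: subspace_def)
  next
    case (step x)
    with orth a(1) show ?case by (auto simp: pairwise_def)
  qed
  with assms(2) a show False by blast
qed

text \<open>Dimension bound, used below to refute a family of six. Stated for lists so that each
  pair is checked once; a repeated entry would be orthogonal to itself and hence null.\<close>

lemma orthogonal_list_length:
  fixes xs :: "(real^5) list"
  assumes "sorted_wrt (\<lambda>x y. \<langle>\<langle>x, y\<rangle>\<rangle> = 0) xs" and nz: "\<And>x. x \<in> set xs \<Longrightarrow> \<langle>\<langle>x, x\<rangle>\<rangle> \<noteq> 0"
  shows "length xs \<le> 5"
proof -
  have "distinct xs \<and> pairwise (\<lambda>x y. \<langle>\<langle>x, y\<rangle>\<rangle> = 0) (set xs)"
    using assms by (induction xs) (auto simp: pairwise_insert lie_inner_commute)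
  moreover have "card (set xs) \<le> 5"
    using independent_bound[OF orthogonal_family_independent[OF conjunct2[OF calculation] nz]]
    by simp
  ultimately show ?thesis by (simp add: distinct_card)
qed

section \<open>Lorentzian geometry of the complement of \<open>\<pp>\<close>, and the vertex
  identity\<close>

lemma cauchy_schwarz_3:
  fixes a b c x y z :: real
  shows "(a*x + b*y + c*z)\<^sup>2 \<le> (a\<^sup>2 + b\<^sup>2 + c\<^sup>2) * (x\<^sup>2 + y\<^sup>2 + z\<^sup>2)"
proof -
  \<comment> \<open>Lagrange's identity: the defect is the squared length of the cross
    product.\<close>
  have "(a\<^sup>2 + b\<^sup>2 + c\<^sup>2) * (x\<^sup>2 + y\<^sup>2 + z\<^sup>2) - (a*x + b*y + c*z)\<^sup>2 =
      (a*y - b*x)\<^sup>2 + (a*z - c*x)\<^sup>2 + (b*z - c*y)\<^sup>2"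
    by (simp add: power2_eq_square algebra_simps)
  then show ?thesis
    by (smt (verit) zero_le_power2)
qed

text \<open>On vectors with vanishing fifth coordinate the form is Lorentzian with time coordinate
  4. If \<open>w\<close> were not spacelike, Cauchy-Schwarz for the spatial parts would contradict
  \<open>V < (v$4)\<^sup>2\<close> unless \<open>w = 0\<close>.\<close>

lemma timelike_orthogonal_definite:
  assumes "w$5 = 0" "v$5 = 0" "\<langle>\<langle>v, v\<rangle>\<rangle> < 0" "\<langle>\<langle>w, v\<rangle>\<rangle> = 0" "w \<noteq> 0"
  shows "\<langle>\<langle>w, w\<rangle>\<rangle> > 0"
proof (rule ccontr)
  define W V where "W = (w$1)\<^sup>2 + (w$2)\<^sup>2 + (w$3)\<^sup>2" and "V = (v$1)\<^sup>2 + (v$2)\<^sup>2 + (v$3)\<^sup>2"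
  assume "\<not> ?thesis"
  then have W: "W \<le> (w$4)\<^sup>2" and V: "V < (v$4)\<^sup>2"
    using assms by (auto simp: lie_inner_def W_def V_def power2_eq_square)
  have nn: "W \<ge> 0" "V \<ge> 0" by (auto simp: W_def V_def)
  have "(w$4 * v$4)\<^sup>2 \<le> W * V"
    using cauchy_schwarz_3[of "w$1" "v$1" "w$2" "v$2" "w$3" "v$3"] assms
    by (simp add: lie_inner_def W_def V_def)
  also have "\<dots> \<le> (w$4)\<^sup>2 * V" using W nn by (simp add: mult_right_mono)
  finally have "(w$4)\<^sup>2 * ((v$4)\<^sup>2 - V) \<le> 0" by (simp add: power_mult_distrib algebra_simps)
  with V have "w$4 = 0" by (simp add: mult_le_0_iff)
  with W have "w$1 = 0 \<and> w$2 = 0 \<and> w$3 = 0"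
    unfolding W_def by (auto simp: sum_power2_le_zero_iff add_nonneg_eq_0_iff dest!: antisym)
  with \<open>w$4 = 0\<close> assms(1) have "w = 0" by (simp add: vec_eq_iff_5)
  with assms(5) show False by simp
qed

text \<open>The plane spanned by \<open>y\<close> and \<open>q\<close> contains the timelike vector \<open>q + k y\<close> for large \<open>k\<close>.\<close>
lemma light_cone_orthogonal_definite:
  assumes "w$5 = 0" "y$5 = 0" "q$5 = 0" "\<langle>\<langle>y, y\<rangle>\<rangle> = 0" "\<langle>\<langle>y, q\<rangle>\<rangle> = -1"
    "\<langle>\<langle>w, y\<rangle>\<rangle> = 0" "\<langle>\<langle>w, q\<rangle>\<rangle> = 0" "w \<noteq> 0"
  shows "\<langle>\<langle>w, w\<rangle>\<rangle> > 0"
proof (rule timelike_orthogonal_definite)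
  \<comment> \<open>Since \<open>y\<close> is null and
    \<open>\<langle>\<langle>y, q\<rangle>\<rangle> = -1\<close>, adding \<open>k\<close> times
    \<open>y\<close> to \<open>q\<close> lowers its square by \<open>2 * k\<close>; this
    \<open>k\<close> makes it \<open>-2\<close>.\<close>
  let ?v = "q + (\<langle>\<langle>q, q\<rangle>\<rangle> / 2 + 1) *\<^sub>R y"
  show "\<langle>\<langle>?v, ?v\<rangle>\<rangle> < 0"
    using assms by (simp add: lie_inner_commute[of q y])
  show "\<langle>\<langle>w, ?v\<rangle>\<rangle> = 0" "?v$5 = 0" using assms by simp_all
qed (use assms in auto)

text \<open>
  With an unknown coefficient \<open>\<gamma>\<close> of \<open>m + n\<close>, both sides have equal products with \<open>y\<close>, \<open>q\<close>,
  \<open>m + n\<close> and \<open>z - x\<close>; if they differed, their difference would give a sixth vector of an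
  orthogonal family in dimension five. Comparing \<open>\<langle>\<langle>x + z, x + z\<rangle>\<rangle>\<close> on both sides then determines \<open>\<gamma>\<close>.
\<close>
lemma vertex_identity:
  fixes x y z m n q :: "real^5" and \<kappa> h :: real
  defines "\<epsilon> \<equiv> - \<langle>\<langle>q, q\<rangle>\<rangle>"
  assumes 5: "x$5 = 0" "y$5 = 0" "z$5 = 0" "q$5 = 0" "m$5 = 0" "n$5 = 0"
    and null: "\<langle>\<langle>x, x\<rangle>\<rangle> = 0" "\<langle>\<langle>y, y\<rangle>\<rangle> = 0" "\<langle>\<langle>z, z\<rangle>\<rangle> = 0"
    and lift: "\<langle>\<langle>x, q\<rangle>\<rangle> = -1" "\<langle>\<langle>y, q\<rangle>\<rangle> = -1" "\<langle>\<langle>z, q\<rangle>\<rangle> = -1"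
    and edge: "\<langle>\<langle>x, y\<rangle>\<rangle> = - h / 2" "\<langle>\<langle>z, y\<rangle>\<rangle> = - h / 2"
    and m: "\<langle>\<langle>m, m\<rangle>\<rangle> = 1" "\<langle>\<langle>m, q\<rangle>\<rangle> = 0" "\<langle>\<langle>m, x\<rangle>\<rangle> = 0" "\<langle>\<langle>m, y\<rangle>\<rangle> = 0"
    and n: "\<langle>\<langle>n, n\<rangle>\<rangle> = 1" "\<langle>\<langle>n, q\<rangle>\<rangle> = 0" "\<langle>\<langle>n, y\<rangle>\<rangle> = 0" "\<langle>\<langle>n, z\<rangle>\<rangle> = 0"
    and \<kappa>: "n - m = (\<kappa> / 2) *\<^sub>R (x - z)" and "x \<noteq> z"
  shows "x + z = (2 - \<epsilon> * h) *\<^sub>R y + h *\<^sub>R q + (\<kappa> * (h * (1 - \<epsilon> * h / 4)) / 2) *\<^sub>R (m + n)"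
proof -
  define P where "P = \<langle>\<langle>x, z\<rangle>\<rangle>"
  define \<zeta> where "\<zeta> = h * (1 - \<epsilon> * h / 4)"
  let ?T = "m + n" and ?d = "z - x"
  note comm = lie_inner_commute[of q y] lie_inner_commute[of q x] lie_inner_commute[of q z]
    lie_inner_commute[of y x] lie_inner_commute[of y z] lie_inner_commute[of z x]
    lie_inner_commute[of n m] lie_inner_commute[of x m] lie_inner_commute[of y m]
    lie_inner_commute[of z m] lie_inner_commute[of q m] lie_inner_commute[of x n]
    lie_inner_commute[of y n] lie_inner_commute[of z n] lie_inner_commute[of q n]
  have qq: "\<langle>\<langle>q, q\<rangle>\<rangle> = - \<epsilon>" by (simp add: \<epsilon>_def)
  note prods = null lift edge m n P_def[symmetric] qq
  have n_eq: "n = m + (\<kappa> / 2) *\<^sub>R (x - z)" using \<kappa> by (simp add: algebra_simps)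
  have m_eq: "m = n - (\<kappa> / 2) *\<^sub>R (x - z)" using n_eq by simp
  \<comment> \<open>Each normal is paired with the point off its edge by passing to the other
    normal.\<close>
  have mz: "\<langle>\<langle>m, z\<rangle>\<rangle> = - \<kappa> * P / 2"
    by (subst m_eq) (simp add: comm prods)
  have nx: "\<langle>\<langle>n, x\<rangle>\<rangle> = - \<kappa> * P / 2"
    by (subst n_eq) (simp add: comm prods)
  have "\<langle>\<langle>n - m, n - m\<rangle>\<rangle> = - \<kappa>\<^sup>2 * P / 2"
    unfolding \<kappa> by (simp add: comm prods power2_eq_square algebra_simps)
  then have mn: "\<langle>\<langle>m, n\<rangle>\<rangle> = 1 + \<kappa>\<^sup>2 * P / 4" by (simp add: comm prods)
  have TT: "\<langle>\<langle>?T, ?T\<rangle>\<rangle> = 4 + \<kappa>\<^sup>2 * P / 2" by (simp add: comm prods mn)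
  have definite: "\<langle>\<langle>w, w\<rangle>\<rangle> > 0"
    if "w$5 = 0" "\<langle>\<langle>w, y\<rangle>\<rangle> = 0" "\<langle>\<langle>w, q\<rangle>\<rangle> = 0" "w \<noteq> 0" for w
    using light_cone_orthogonal_definite[of w y q] that 5 prods by simp
  \<comment> \<open>If \<open>m = - n\<close>, pairing with \<open>x + z\<close> gives
    \<open>\<kappa> * P = 0\<close>, so the square of \<open>?T\<close> would be 4.\<close>
  have "?T \<noteq> 0"
  proof
    assume T: "?T = 0"
    then have "\<langle>\<langle>?T, x + z\<rangle>\<rangle> = 0" by (simp del: lie_inner_linear(1,2))
    then have "\<kappa> * P = 0" by (simp add: prods mz nx mult.commute)
    with TT T show False by (auto simp: power2_eq_square)
  qed
  then have TTpos: "\<langle>\<langle>?T, ?T\<rangle>\<rangle> > 0" by (intro definite) (simp_all add: 5 prods)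
  have ddpos: "\<langle>\<langle>?d, ?d\<rangle>\<rangle> > 0"
    using \<open>x \<noteq> z\<close> by (intro definite) (simp_all add: 5 prods)
  \<comment> \<open>Forced by pairing the ansatz with \<open>?T\<close>, which is orthogonal to
    \<open>y\<close> and \<open>q\<close>.\<close>
  define \<gamma> where "\<gamma> = - \<kappa> * P / (4 + \<kappa>\<^sup>2 * P / 2)"
  have \<gamma>: "\<gamma> * (4 + \<kappa>\<^sup>2 * P / 2) = - \<kappa> * P" using TTpos unfolding TT \<gamma>_def by simp
  define w where "w = x + z - (2 - \<epsilon> * h) *\<^sub>R y - h *\<^sub>R q - \<gamma> *\<^sub>R ?T"
  have w5: "w$5 = 0" by (simp add: w_def 5)
  have wy: "\<langle>\<langle>w, y\<rangle>\<rangle> = 0" by (simp add: w_def comm prods)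
  have wq: "\<langle>\<langle>w, q\<rangle>\<rangle> = 0" by (simp add: w_def comm prods algebra_simps)
  have wd: "\<langle>\<langle>w, ?d\<rangle>\<rangle> = 0" by (simp add: w_def comm prods mz nx)
  have wT: "\<langle>\<langle>w, ?T\<rangle>\<rangle> = 0"
    using \<gamma> by (simp add: w_def comm prods mz nx mn algebra_simps)
  have "w = 0"
  proof (rule ccontr)
    assume "w \<noteq> 0"
    then have ww: "\<langle>\<langle>w, w\<rangle>\<rangle> > 0" using definite w5 wy wq by blast
    \<comment> \<open>The second null direction in the plane of \<open>y\<close> and
      \<open>q\<close>, scaled so that \<open>y + r\<close> and \<open>y - r\<close> are orthogonal
      with squares \<open>-2\<close> and \<open>2\<close>.\<close>
    define r where "r = q - (\<epsilon> / 2) *\<^sub>R y"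
    have r: "\<langle>\<langle>r, r\<rangle>\<rangle> = 0" "\<langle>\<langle>y, r\<rangle>\<rangle> = -1" "\<langle>\<langle>r, y\<rangle>\<rangle> = -1"
      by (simp_all add: r_def comm prods)
    have orth: "\<langle>\<langle>r, v\<rangle>\<rangle> = 0" "\<langle>\<langle>y, v\<rangle>\<rangle> = 0" if "\<langle>\<langle>v, y\<rangle>\<rangle> = 0" "\<langle>\<langle>v, q\<rangle>\<rangle> = 0" for v
      using that by (simp_all add: r_def lie_inner_commute[of _ v])
    have Td: "\<langle>\<langle>?T, ?d\<rangle>\<rangle> = 0" by (simp add: prods mz nx)
    have "length [y + r, y - r, w, ?T, ?d, \<pp>] \<le> 5"
    proof (rule orthogonal_list_length)
      have pp: "\<langle>\<langle>v, \<pp>\<rangle>\<rangle> = 0" if "v$5 = 0" for v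
        using that by (simp add: lie_inner_point_complex)
      have T_: "\<langle>\<langle>y, ?T\<rangle>\<rangle> = 0" "\<langle>\<langle>r, ?T\<rangle>\<rangle> = 0" "\<langle>\<langle>y, ?d\<rangle>\<rangle> = 0" "\<langle>\<langle>r, ?d\<rangle>\<rangle> = 0"
        by (intro orth; simp add: prods)+
      have "\<langle>\<langle>y, w\<rangle>\<rangle> = 0" "\<langle>\<langle>r, w\<rangle>\<rangle> = 0" using orth wy wq by auto
      moreover have "\<langle>\<langle>y + r, y - r\<rangle>\<rangle> = 0" by (simp add: r prods)
      moreover have "r$5 = 0" by (simp add: r_def 5)
      ultimately show "sorted_wrt (\<lambda>x y. \<langle>\<langle>x, y\<rangle>\<rangle> = 0) [y + r, y - r, w, ?T, ?d, \<pp>]"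
        using T_ wd wT Td w5
        by (simp add: pp 5 del: lie_inner_linear) (simp add: r prods)
      fix v assume "v \<in> set [y + r, y - r, w, ?T, ?d, \<pp>]"
      moreover have "\<langle>\<langle>y + r, y + r\<rangle>\<rangle> \<noteq> 0" "\<langle>\<langle>y - r, y - r\<rangle>\<rangle> \<noteq> 0" by (simp_all add: r prods)
      moreover have "\<langle>\<langle>\<pp>, \<pp>\<rangle>\<rangle> \<noteq> 0" by simp
      ultimately show "\<langle>\<langle>v, v\<rangle>\<rangle> \<noteq> 0" using ww TTpos ddpos
        by (simp del: lie_inner_linear lie_inner_point_complex_self) (metis less_irrefl)
    qed
    then show False by simp
  qed
  then have xz: "x + z = (2 - \<epsilon> * h) *\<^sub>R y + h *\<^sub>R q + \<gamma> *\<^sub>R ?T" by (simp add: w_def algebra_simps)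
  \<comment> \<open>Only one of the two factors is expanded, which keeps the equation linear in
    \<open>\<gamma>\<close>.\<close>
  have "\<langle>\<langle>x + z, x + z\<rangle>\<rangle> = - 4 * \<zeta> - \<gamma> * \<kappa> * P"
    by (subst (2) xz) (simp add: comm prods mz nx \<zeta>_def algebra_simps)
  then have "2 * P + 4 * \<zeta> = - \<gamma> * \<kappa> * P" by (simp add: comm prods)
  then have "(2 * P + 4 * \<zeta>) * (4 + \<kappa>\<^sup>2 * P / 2) = (\<kappa> * P)\<^sup>2"
    using \<gamma> by algebra
  \<comment> \<open>The terms quadratic in \<open>P\<close> cancel.\<close>
  then have P: "P * (4 + \<kappa>\<^sup>2 * \<zeta>) = - 8 * \<zeta>" by (simp add: power2_eq_square algebra_simps)
  \<comment> \<open>As this product is a nonzero constant, multiplying the equation for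
    \<open>\<gamma>\<close> by its first factor isolates \<open>\<gamma>\<close> without a
    division.\<close>
  have "(4 + \<kappa>\<^sup>2 * \<zeta>) * (4 + \<kappa>\<^sup>2 * P / 2) = 16"
    using P by algebra
  moreover have "(4 + \<kappa>\<^sup>2 * \<zeta>) * (\<gamma> * (4 + \<kappa>\<^sup>2 * P / 2)) = 8 * \<kappa> * \<zeta>"
    unfolding \<gamma> using P by algebra
  ultimately have "\<gamma> * 16 = 8 * \<kappa> * \<zeta>" by (metis mult.left_commute)
  then have "\<gamma> = \<kappa> * \<zeta> / 2" by simp
  with xz show ?thesis by (simp add: \<zeta>_def)
qed

section \<open>Signs and bounds for products of points, and injectivity of the distance\<close>

lemma null_vector_fourth_nonzero:
  assumes "x$5 = 0" "\<langle>\<langle>x, x\<rangle>\<rangle> = 0" "x \<noteq> 0"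
  shows "x$4 \<noteq> 0"
proof
  assume "x$4 = 0"
  with assms have "(x$1)\<^sup>2 + (x$2)\<^sup>2 + (x$3)\<^sup>2 = 0"
    by (simp add: lie_inner_def power2_eq_square)
  then have "x$1 = 0 \<and> x$2 = 0 \<and> x$3 = 0"
    by (auto simp: add_nonneg_eq_0_iff)
  with \<open>x$4 = 0\<close> assms show False by (simp add: vec_eq_iff_5)
qed

text \<open>The spatial part of a null vector has length \<open>\<bar>x$4\<bar>\<close>, so
  Cauchy-Schwarz bounds the spatial product by \<open>x$4 * y$4\<close> on a common half of the
  cone.\<close>

lemma light_cone_inner_nonpos:
  assumes "x$5 = 0" "y$5 = 0" "\<langle>\<langle>x, x\<rangle>\<rangle> = 0" "\<langle>\<langle>y, y\<rangle>\<rangle> = 0" "x$4 * y$4 \<ge> 0"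
  shows "\<langle>\<langle>x, y\<rangle>\<rangle> \<le> 0"
proof -
  have "(x$1 * y$1 + x$2 * y$2 + x$3 * y$3)\<^sup>2 \<le>
      ((x$1)\<^sup>2 + (x$2)\<^sup>2 + (x$3)\<^sup>2) * ((y$1)\<^sup>2 + (y$2)\<^sup>2 + (y$3)\<^sup>2)"
    by (rule cauchy_schwarz_3)
  also have "\<dots> = (x$4 * y$4)\<^sup>2"
    using assms by (simp add: lie_inner_def power2_eq_square)
  finally have "x$1 * y$1 + x$2 * y$2 + x$3 * y$3 \<le> x$4 * y$4"
    using assms(5) by (rule power2_le_imp_le)
  then show ?thesis using assms(1) by (simp add: lie_inner_def)
qed

text \<open>Puts all points in one half of the light cone when \<open>\<epsilon> \<ge> 0\<close>:
  Cauchy-Schwarz gives \<open>(x$4 * q$4 - 1)\<^sup>2 \<le> (x$4 * q$4)\<^sup>2\<close>.\<close>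

lemma causal_vector_same_cone:
  assumes "x$5 = 0" "q$5 = 0" "\<langle>\<langle>x, x\<rangle>\<rangle> = 0" "\<langle>\<langle>q, q\<rangle>\<rangle> \<le> 0" "\<langle>\<langle>x, q\<rangle>\<rangle> = -1"
  shows "x$4 * q$4 > 0"
proof -
  have "(x$1 * q$1 + x$2 * q$2 + x$3 * q$3)\<^sup>2 \<le>
      ((x$1)\<^sup>2 + (x$2)\<^sup>2 + (x$3)\<^sup>2) * ((q$1)\<^sup>2 + (q$2)\<^sup>2 + (q$3)\<^sup>2)"
    by (rule cauchy_schwarz_3)
  also have "\<dots> \<le> (x$4)\<^sup>2 * (q$4)\<^sup>2"
    using assms by (intro mult_mono) (simp_all add: lie_inner_def power2_eq_square)
  also have "x$1 * q$1 + x$2 * q$2 + x$3 * q$3 = x$4 * q$4 - 1"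
    using assms by (simp add: lie_inner_def)
  finally show ?thesis by (simp add: power2_eq_square algebra_simps)
qed

lemma space_form_vector_fifth: "space_form_vector q \<Longrightarrow> q$5 = 0"
  using lie_inner_point_complex[of q] by (simp add: space_form_vector_def lie_inner_commute)

lemma space_formD:
  assumes "x \<in> space_form q"
  shows "x$5 = 0" "\<langle>\<langle>x, x\<rangle>\<rangle> = 0" "\<langle>\<langle>x, q\<rangle>\<rangle> = -1" "x$4 \<noteq> 0"
proof -
  show *: "x$5 = 0" "\<langle>\<langle>x, x\<rangle>\<rangle> = 0" "\<langle>\<langle>x, q\<rangle>\<rangle> = -1"
    using assms by (auto simp: space_form_def lie_inner_point_complex)
  then have "x \<noteq> 0" by auto
  with * show "x$4 \<noteq> 0" using null_vector_fourth_nonzero by blast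
qed

text \<open>The points lie in the same half of the light cone, which gives the weak inequality. It
  is strict because orthogonal \<open>x\<close> and \<open>y\<close> would make \<open>x - y\<close>
  a nonzero null vector orthogonal to \<open>y\<close> and \<open>q\<close>.\<close>

lemma space_form_inner_neg:
  assumes q: "space_form_vector q" and x: "x \<in> space_form q" and y: "y \<in> space_form q"
    and "x \<noteq> y" and side: "sectional_curvature q < 0 \<Longrightarrow> boundary_side q x = boundary_side q y"
  shows "\<langle>\<langle>x, y\<rangle>\<rangle> < 0"
proof -
  note X = space_formD[OF x] and Y = space_formD[OF y] and q5 = space_form_vector_fifth[OF q]
  have "x$4 * y$4 \<ge> 0"
  proof (cases "sectional_curvature q < 0")
    case True
    \<comment> \<open>As \<open>\<langle>\<langle>x, q\<rangle>\<rangle> = -1\<close>, the boundary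
      side is minus the sign of the fourth coordinate.\<close>
    then have "sgn (x$4) = sgn (y$4)"
      using side X Y by (simp add: boundary_side_def sgn_divide)
    then show ?thesis by (auto simp: sgn_if zero_le_mult_iff split: if_splits)
  next
    case False
    then have "\<langle>\<langle>q, q\<rangle>\<rangle> \<le> 0" by (simp add: sectional_curvature_def)
    then have "x$4 * q$4 > 0" "y$4 * q$4 > 0" using causal_vector_same_cone X Y q5 by blast+
    then show ?thesis by (auto simp: zero_less_mult_iff zero_le_mult_iff)
  qed
  then have "\<langle>\<langle>x, y\<rangle>\<rangle> \<le> 0" using light_cone_inner_nonpos X Y by blast
  moreover have "\<langle>\<langle>x, y\<rangle>\<rangle> \<noteq> 0"
  proof
    assume "\<langle>\<langle>x, y\<rangle>\<rangle> = 0"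
    then have "\<langle>\<langle>x - y, x - y\<rangle>\<rangle> > 0"
      using X Y q5 \<open>x \<noteq> y\<close> by (intro light_cone_orthogonal_definite[of _ y q]) auto
    then show False
      using \<open>\<langle>\<langle>x, y\<rangle>\<rangle> = 0\<close> X Y by (simp add: lie_inner_commute[of y x])
  qed
  ultimately show ?thesis by simp
qed

lemma not_antipodal_inner:
  assumes q: "space_form_vector q" and x: "x \<in> space_form q" and y: "y \<in> space_form q"
    and pos: "sectional_curvature q > 0" and "\<not> antipodal q x y"
  shows "sectional_curvature q * \<langle>\<langle>x, y\<rangle>\<rangle> > -2"
proof -
  define \<epsilon> where "\<epsilon> = sectional_curvature q"
  have qq: "\<langle>\<langle>q, q\<rangle>\<rangle> = - \<epsilon>" and \<epsilon>: "\<epsilon> > 0" using pos by (simp_all add: \<epsilon>_def sectional_curvature_def)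
  note X = space_formD[OF x] and Y = space_formD[OF y] and q5 = space_form_vector_fifth[OF q]
  \<comment> \<open>Twice the offset of the midpoint of \<open>x\<close> and \<open>y\<close> from
    the centre of the sphere: orthogonal to the timelike \<open>q\<close>, and zero only for
    antipodal points.\<close>
  define w where "w = x + y - (2 / \<epsilon>) *\<^sub>R q"
  have "w \<noteq> 0"
  proof
    assume "w = 0"
    moreover have "w = (x - (1 / \<epsilon>) *\<^sub>R q) + (y - (1 / \<epsilon>) *\<^sub>R q)"
      by (simp add: w_def vec_eq_iff)
    ultimately have "antipodal q x y"
      unfolding antipodal_def \<epsilon>_def[symmetric] Let_def by (metis eq_neg_iff_add_eq_0)
    with assms(5) show False by simp
  qed
  then have "\<langle>\<langle>w, w\<rangle>\<rangle> > 0"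
    using X Y q5 qq \<epsilon> by (intro timelike_orthogonal_definite[of w q]) (simp_all add: w_def)
  also have "\<langle>\<langle>w, w\<rangle>\<rangle> = 2 * \<langle>\<langle>x, y\<rangle>\<rangle> + 4 / \<epsilon>"
    using X Y qq \<epsilon>
    by (simp add: w_def lie_inner_commute[of y x] lie_inner_commute[of q x]
        lie_inner_commute[of q y] field_simps)
  finally show ?thesis using \<epsilon> by (simp add: \<epsilon>_def[symmetric] field_simps)
qed

text \<open>The sign conditions and bounds keep the arguments where \<open>arccos\<close> and
  \<open>arcosh\<close> are injective.\<close>

lemma space_form_dist_inj:
  assumes eq: "space_form_dist q x y = space_form_dist q u v"
    and neg: "\<langle>\<langle>x, y\<rangle>\<rangle> \<le> 0" "\<langle>\<langle>u, v\<rangle>\<rangle> \<le> 0"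
    and bound: "sectional_curvature q > 0 \<Longrightarrow> sectional_curvature q * \<langle>\<langle>x, y\<rangle>\<rangle> \<ge> -2"
      "sectional_curvature q > 0 \<Longrightarrow> sectional_curvature q * \<langle>\<langle>u, v\<rangle>\<rangle> \<ge> -2"
  shows "\<langle>\<langle>x, y\<rangle>\<rangle> = \<langle>\<langle>u, v\<rangle>\<rangle>"
proof -
  define \<epsilon> where "\<epsilon> = sectional_curvature q"
  consider "\<epsilon> > 0" | "\<epsilon> = 0" | "\<epsilon> < 0" by linarith
  then show ?thesis
  proof cases
    case 1
    then have "arccos (1 + \<epsilon> * \<langle>\<langle>x, y\<rangle>\<rangle>) = arccos (1 + \<epsilon> * \<langle>\<langle>u, v\<rangle>\<rangle>)"
      using eq by (simp add: space_form_dist_def Let_def \<epsilon>_def)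
    moreover have "\<epsilon> * \<langle>\<langle>x, y\<rangle>\<rangle> \<le> 0" "\<epsilon> * \<langle>\<langle>u, v\<rangle>\<rangle> \<le> 0"
      using 1 neg by (simp_all add: mult_nonneg_nonpos)
    ultimately have "1 + \<epsilon> * \<langle>\<langle>x, y\<rangle>\<rangle> = 1 + \<epsilon> * \<langle>\<langle>u, v\<rangle>\<rangle>"
      using bound 1 unfolding \<epsilon>_def[symmetric] by (subst (asm) arccos_eq_iff) (auto simp: abs_le_iff)
    with 1 show ?thesis by simp
  next
    case 2
    with eq show ?thesis by (simp add: space_form_dist_def Let_def \<epsilon>_def)
  next
    case 3
    then have "arcosh (1 + \<epsilon> * \<langle>\<langle>x, y\<rangle>\<rangle>) = arcosh (1 + \<epsilon> * \<langle>\<langle>u, v\<rangle>\<rangle>)"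
      using eq by (simp add: space_form_dist_def Let_def \<epsilon>_def)
    moreover have "\<epsilon> * \<langle>\<langle>x, y\<rangle>\<rangle> \<ge> 0" "\<epsilon> * \<langle>\<langle>u, v\<rangle>\<rangle> \<ge> 0"
      using 3 neg by (simp_all add: mult_nonpos_nonpos)
    ultimately have "1 + \<epsilon> * \<langle>\<langle>x, y\<rangle>\<rangle> = 1 + \<epsilon> * \<langle>\<langle>u, v\<rangle>\<rangle>"
      by (metis cosh_arcosh_real le_add_same_cancel1)
    with 3 show ?thesis by simp
  qed
qed

section \<open>Curvature, edge constants and vertex relations of a discrete curve\<close>

lemma curvature_eq:
  assumes "f (i - 1) \<noteq> f (i + 1)" "\<exists>c \<kappa>. double_curvature_circle f t i c \<kappa>"
  shows "t i - t (i - 1) = (curvature f t i / 2) *\<^sub>R (f (i - 1) - f (i + 1))"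
proof -
  \<comment> \<open>Eliminating the circle leaves one vector equation, whose coefficient is unique
    because the two neighbours differ.\<close>
  have *: "(\<exists>c. double_curvature_circle f t i c \<kappa>) \<longleftrightarrow>
      t i - t (i - 1) = (\<kappa> / 2) *\<^sub>R (f (i - 1) - f (i + 1))" for \<kappa>
    by (auto simp: double_curvature_circle_def algebra_simps)
  obtain \<kappa> where \<kappa>: "t i - t (i - 1) = (\<kappa> / 2) *\<^sub>R (f (i - 1) - f (i + 1))"
    using assms(2) * by blast
  have "curvature f t i = \<kappa>"
    unfolding curvature_def * using \<kappa> assms(1) by (intro the_equality) auto
  with \<kappa> show ?thesis by simp
qed

text \<open>Constant distance becomes a constant product, so \<open>eta\<close>, read off edge 0,
  serves every edge. For \<open>\<epsilon> > 0\<close>, excluding antipodal neighbours yields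
  \<open>\<epsilon> * (eta f)\<^sup>2 < 4\<close>, hence positivity of
  \<open>zeta_squared\<close>.\<close>

lemma discrete_curve_edge:
  assumes q: "space_form_vector q" and ft: "(f, t) \<in> discrete_curves q"
  shows "eta f > 0" "zeta_squared q f > 0" "\<langle>\<langle>f i, f (i + 1)\<rangle>\<rangle> = - (eta f)\<^sup>2 / 2"
proof -
  let ?\<epsilon> = "sectional_curvature q"
  have sf: "f i \<in> space_form q" and ne: "f i \<noteq> f (i + 1)" for i
    using ft by (auto simp: discrete_curves_def)
  have neg: "\<langle>\<langle>f i, f (i + 1)\<rangle>\<rangle> < 0" for i
    using ft by (intro space_form_inner_neg[OF q sf sf ne]) (auto simp: discrete_curves_def)
  have anti: "?\<epsilon> * \<langle>\<langle>f i, f (i + 1)\<rangle>\<rangle> > -2" if "?\<epsilon> > 0" for i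
    using ft that by (intro not_antipodal_inner[OF q sf sf]) (auto simp: discrete_curves_def)
  obtain d where d: "\<And>i. space_form_dist q (f i) (f (i + 1)) = d"
    using ft by (auto simp: discrete_curves_def)
  have const: "\<langle>\<langle>f i, f (i + 1)\<rangle>\<rangle> = \<langle>\<langle>f 0, f (0 + 1)\<rangle>\<rangle>" for i
    by (intro space_form_dist_inj[of q]) (auto simp only: d intro: less_imp_le neg anti)
  show pos: "eta f > 0" using neg[of 0] by (simp add: eta_def)
  have eta: "(eta f)\<^sup>2 = - 2 * \<langle>\<langle>f 0, f 1\<rangle>\<rangle>" using neg[of 0] by (simp add: eta_def)
  show "\<langle>\<langle>f i, f (i + 1)\<rangle>\<rangle> = - (eta f)\<^sup>2 / 2" using const[of i] eta by simp
  have "?\<epsilon> * (eta f)\<^sup>2 < 4"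
  proof (cases "?\<epsilon> > 0")
    case True
    with anti[of 0] eta show ?thesis by simp
  next
    case False
    then have "?\<epsilon> * (eta f)\<^sup>2 \<le> 0" by (simp add: mult_nonpos_nonneg)
    then show ?thesis by simp
  qed
  with pos show "zeta_squared q f > 0" by (simp add: zeta_squared_def)
qed

lemma discrete_curve_vertex:
  assumes q: "space_form_vector q" and ft: "(f, t) \<in> discrete_curves q"
  defines "\<kappa> \<equiv> curvature f t" and "n \<equiv> \<lambda>i. t i - \<pp>"
  shows "n i - n (i - 1) = (\<kappa> i / 2) *\<^sub>R (f (i - 1) - f (i + 1))"
    and "f (i - 1) + f (i + 1) = (2 - sectional_curvature q * (eta f)\<^sup>2) *\<^sub>R f i +
      (eta f)\<^sup>2 *\<^sub>R q + (\<kappa> i * zeta_squared q f / 2) *\<^sub>R (n (i - 1) + n i)"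
    and "\<langle>\<langle>n i, n i\<rangle>\<rangle> = 1" "\<langle>\<langle>n i, q\<rangle>\<rangle> = 0" "\<langle>\<langle>n i, f i\<rangle>\<rangle> = 0" "\<langle>\<langle>n i, f (i + 1)\<rangle>\<rangle> = 0" "n i $ 5 = 0"
proof -
  have sf: "f j \<in> space_form q" and ne: "f (j - 1) \<noteq> f (j + 1)"
    and ex: "\<exists>c \<kappa>. double_curvature_circle f t j c \<kappa>"
    and lift: "geodesic_lift q (f j) (f (j + 1)) (t j)" for j
    using ft by (auto simp: discrete_curves_def)
  note F = space_formD[OF sf] and q5 = space_form_vector_fifth[OF q]
  have pf: "\<langle>\<langle>\<pp>, f j\<rangle>\<rangle> = 0" for j
    by (simp add: lie_inner_commute[of \<pp>] lie_inner_point_complex F)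
  have pq: "\<langle>\<langle>\<pp>, q\<rangle>\<rangle> = 0" using q by (simp add: space_form_vector_def)
  \<comment> \<open>The lift normalisation gives \<open>t j\<close> fifth coordinate 1, so
    subtracting \<open>\<pp>\<close> removes it and turns the null vector into a unit one.\<close>
  have n: "\<langle>\<langle>n j, n j\<rangle>\<rangle> = 1" "\<langle>\<langle>n j, q\<rangle>\<rangle> = 0" "\<langle>\<langle>n j, f j\<rangle>\<rangle> = 0" "\<langle>\<langle>n j, f (j + 1)\<rangle>\<rangle> = 0"
      "n j $ 5 = 0" for j
    using lift[of j] lie_inner_point_complex[of "t j"]
    by (simp_all add: n_def geodesic_lift_def pf pq lie_inner_commute[of \<pp> "t j"])
       (simp add: point_complex_def axis_def)
  then show "\<langle>\<langle>n i, n i\<rangle>\<rangle> = 1" "\<langle>\<langle>n i, q\<rangle>\<rangle> = 0" "\<langle>\<langle>n i, f i\<rangle>\<rangle> = 0" "\<langle>\<langle>n i, f (i + 1)\<rangle>\<rangle> = 0" "n i $ 5 = 0"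
    by blast+
  show \<kappa>: "n i - n (i - 1) = (\<kappa> i / 2) *\<^sub>R (f (i - 1) - f (i + 1))"
    using curvature_eq[of f i t, OF ne ex] by (simp add: n_def \<kappa>_def)
  have edge: "\<langle>\<langle>f (i - 1), f i\<rangle>\<rangle> = - (eta f)\<^sup>2 / 2" "\<langle>\<langle>f (i + 1), f i\<rangle>\<rangle> = - (eta f)\<^sup>2 / 2"
    using discrete_curve_edge(3)[OF q ft, of "i - 1"] discrete_curve_edge(3)[OF q ft, of i]
    by (simp_all add: lie_inner_commute[of "f (i + 1)"])
  have "f (i - 1) + f (i + 1) = (2 - - \<langle>\<langle>q, q\<rangle>\<rangle> * (eta f)\<^sup>2) *\<^sub>R f i + (eta f)\<^sup>2 *\<^sub>R q +
      (\<kappa> i * ((eta f)\<^sup>2 * (1 - - \<langle>\<langle>q, q\<rangle>\<rangle> * (eta f)\<^sup>2 / 4)) / 2) *\<^sub>R (n (i - 1) + n i)"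
    using n[of i] n[of "i - 1"]
    by (intro vertex_identity[OF _ _ _ _ _ _ _ _ _ _ _ _ _ _ _ _ _ _ _ _ _ _ \<kappa> ne])
       (simp_all add: F q5 edge)
  then show "f (i - 1) + f (i + 1) = (2 - sectional_curvature q * (eta f)\<^sup>2) *\<^sub>R f i +
      (eta f)\<^sup>2 *\<^sub>R q + (\<kappa> i * zeta_squared q f / 2) *\<^sub>R (n (i - 1) + n i)"
    by (simp add: zeta_squared_def sectional_curvature_def)
qed

section \<open>Solving on an initial edge and propagating along the curve\<close>

lemma discrete_curve_edge_solve:
  assumes q: "space_form_vector q" and ft: "(f, t) \<in> discrete_curves q"
  obtains a where "a \<noteq> 0" "\<langle>\<langle>f 0, a\<rangle>\<rangle> = \<alpha>" "\<langle>\<langle>f 1, a\<rangle>\<rangle> = \<beta>" "\<langle>\<langle>q, a\<rangle>\<rangle> = \<gamma>" "\<langle>\<langle>t 0 - \<pp>, a\<rangle>\<rangle> = \<delta>"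
proof -
  define \<epsilon> where "\<epsilon> = sectional_curvature q"
  define e where "e = (eta f)\<^sup>2 / 2"
  define n where "n = t 0 - \<pp>"
  have sf: "f i \<in> space_form q" for i using ft by (auto simp: discrete_curves_def)
  note F = space_formD[OF sf] and q5 = space_form_vector_fifth[OF q]
  have qq: "\<langle>\<langle>q, q\<rangle>\<rangle> = - \<epsilon>" by (simp add: \<epsilon>_def sectional_curvature_def)
  have edge: "\<langle>\<langle>f 0, f 1\<rangle>\<rangle> = - e"
    using discrete_curve_edge(3)[OF q ft, of 0] by (simp add: e_def)
  have n: "\<langle>\<langle>n, n\<rangle>\<rangle> = 1" "\<langle>\<langle>n, q\<rangle>\<rangle> = 0" "\<langle>\<langle>n, f 0\<rangle>\<rangle> = 0" "\<langle>\<langle>n, f 1\<rangle>\<rangle> = 0" "n$5 = 0"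
    using discrete_curve_vertex(3-7)[OF q ft, of 0] by (simp_all add: n_def)
  have e: "e > 0" using discrete_curve_edge(1)[OF q ft] by (simp add: e_def)
  have "2 * e * (1 - \<epsilon> * e / 2) > 0"
    using discrete_curve_edge(2)[OF q ft] by (simp add: e_def zeta_squared_def \<epsilon>_def)
  \<comment> \<open>The Gram determinant of \<open>f 0\<close>, \<open>f 1\<close>, \<open>q\<close>
    is \<open>- e * (2 - \<epsilon> * e)\<close>, which is minus \<open>zeta_squared\<close>;
    \<open>n\<close> is orthogonal to all three.\<close>
  with e have det: "2 - \<epsilon> * e > 0" by (simp add: zero_less_mult_iff)
  \<comment> \<open>The coefficient of \<open>q\<close> in \<open>a\<close>. The conditions at
    \<open>f 0\<close> and \<open>f 1\<close> express the other two coefficients through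
    \<open>c\<close>, and the condition at \<open>q\<close> is then linear in
    \<open>c\<close>.\<close>
  define c where "c = (e * \<gamma> - \<alpha> - \<beta>) / (2 - \<epsilon> * e)"
  have c: "c * (2 - \<epsilon> * e) = e * \<gamma> - \<alpha> - \<beta>" using det by (simp add: c_def)
  define a where "a = (- (\<beta> + c) / e) *\<^sub>R f 0 + (- (\<alpha> + c) / e) *\<^sub>R f 1 + c *\<^sub>R q + \<delta> *\<^sub>R n + \<pp>"
  have pp: "\<langle>\<langle>x, \<pp>\<rangle>\<rangle> = 0" if "x$5 = 0" for x using that by (simp add: lie_inner_point_complex)
  note prods = F edge n qq pp[OF F(1)] pp[OF q5] pp[OF n(5)] lie_inner_commute[of "f 1" "f 0"]
    lie_inner_commute[of "f 0" n] lie_inner_commute[of "f 1" n] lie_inner_commute[of q n]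
    lie_inner_commute[of q "f 0"] lie_inner_commute[of q "f 1"]
  have "a$5 = 1" by (simp add: a_def F q5 n point_complex_def axis_def)
  then have "a \<noteq> 0" by auto
  moreover have "\<langle>\<langle>f 0, a\<rangle>\<rangle> = \<alpha>" using e by (simp add: a_def prods)
  moreover have "\<langle>\<langle>f 1, a\<rangle>\<rangle> = \<beta>" using e by (simp add: a_def prods)
  moreover have "\<langle>\<langle>q, a\<rangle>\<rangle> = \<gamma>"
  proof -
    have "\<langle>\<langle>q, a\<rangle>\<rangle> = (\<alpha> + \<beta> + 2 * c) / e - \<epsilon> * c"
      using e by (simp add: a_def prods field_simps)
    also have "\<dots> = \<gamma>" using e c by (simp add: field_simps)
    finally show ?thesis .
  qed
  moreover have "\<langle>\<langle>t 0 - \<pp>, a\<rangle>\<rangle> = \<delta>"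
    by (simp add: a_def prods n_def[symmetric] del: lie_inner_linear(3))
  ultimately show thesis using that by blast
qed

text \<open>
  Symmetric under exchanging \<open>k\<^sub>0\<close>, \<open>Y\<close> with \<open>X\<close>, \<open>Y'\<close>, so it serves to continue
  along the curve in both directions.
\<close>
lemma elastic_step:
  fixes X Y Y' k k\<^sub>0 k\<^sub>1 z A C D :: real
  assumes "z > 0" and sum: "k\<^sub>0 + X = A * k + D + k * z / 2 * (Y + Y')"
    and diff: "Y' - Y = k / 2 * (k\<^sub>0 - X)" and Y: "Y = C - k\<^sub>0 * k / 2"
    and elastic: "(k\<^sub>0 + k\<^sub>1) * (1 + z / 4 * k\<^sup>2) = (A + C * z) * k + D"
  shows "X = k\<^sub>1 \<and> Y' = C - k * k\<^sub>1 / 2"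
proof -
  have Y': "Y' = C - k * X / 2" using diff Y by (simp add: field_simps)
  \<comment> \<open>Inserted into \<open>sum\<close>, the part with \<open>k\<^sub>0 + X\<close>
    moves to the left and creates the factor \<open>1 + z / 4 * k\<^sup>2\<close>, which is positive
    and cancels.\<close>
  have YY': "Y + Y' = 2 * C - k / 2 * (k\<^sub>0 + X)" using Y Y' by (simp add: field_simps)
  have "(k\<^sub>0 + X) * (1 + z / 4 * k\<^sup>2) - ((A + C * z) * k + D) =
      (k\<^sub>0 + X) - (A * k + D + k * z / 2 * (Y + Y'))"
    unfolding YY' by (simp add: field_simps power2_eq_square)
  then have "(k\<^sub>0 + X) * (1 + z / 4 * k\<^sup>2) = (k\<^sub>0 + k\<^sub>1) * (1 + z / 4 * k\<^sup>2)"
    unfolding elastic using sum by linarith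
  moreover have "1 + z / 4 * k\<^sup>2 > 0" using \<open>z > 0\<close> by (simp add: add_pos_nonneg)
  ultimately have "X = k\<^sub>1" by simp
  with Y' show ?thesis by simp
qed

theorem proposition17:
  fixes q :: "real^5" and f t :: "int \<Rightarrow> real^5"
  assumes "space_form_vector q"
    and "(f, t) \<in> discrete_curves q"
  shows "constrained_elastic q f t \<longleftrightarrow>
    (\<exists>(a :: real^5) (\<omega> :: real). a \<noteq> 0 \<and> \<omega> \<noteq> 0 \<and>
      (\<forall>i. curvature f t i = \<omega> * \<langle>\<langle>f i, a\<rangle>\<rangle>))"
proof -
  define \<kappa> where "\<kappa> = curvature f t"
  define n where "n i = t i - \<pp>" for i
  define h where "h = (eta f)\<^sup>2"
  define z where "z = zeta_squared q f"
  define A where "A = 2 - sectional_curvature q * h"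
  note vertex = discrete_curve_vertex[OF assms, folded \<kappa>_def n_def h_def z_def, folded A_def]
  have h: "h > 0" and z: "z > 0"
    using discrete_curve_edge(1,2)[OF assms] by (simp_all add: h_def z_def)
  have pos: "1 + z / 4 * k\<^sup>2 > 0" for k using z by (simp add: add_pos_nonneg)
  have sum: "\<langle>\<langle>f (i - 1), a\<rangle>\<rangle> + \<langle>\<langle>f (i + 1), a\<rangle>\<rangle> = A * \<langle>\<langle>f i, a\<rangle>\<rangle> + h * \<langle>\<langle>q, a\<rangle>\<rangle> +
      \<kappa> i * z / 2 * (\<langle>\<langle>n (i - 1), a\<rangle>\<rangle> + \<langle>\<langle>n i, a\<rangle>\<rangle>)" for i a
    using arg_cong[OF vertex(2), of "\<lambda>x. \<langle>\<langle>x, a\<rangle>\<rangle>" i] by simp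
  have diff: "\<langle>\<langle>n i, a\<rangle>\<rangle> - \<langle>\<langle>n (i - 1), a\<rangle>\<rangle> =
      \<kappa> i / 2 * (\<langle>\<langle>f (i - 1), a\<rangle>\<rangle> - \<langle>\<langle>f (i + 1), a\<rangle>\<rangle>)" for i a
    using arg_cong[OF vertex(1), of "\<lambda>x. \<langle>\<langle>x, a\<rangle>\<rangle>" i] by simp
  have divide: "x = y / (1 + z / 4 * k\<^sup>2) \<longleftrightarrow> x * (1 + z / 4 * k\<^sup>2) = y" for x y k
    by (rule nonzero_eq_divide_eq) (use pos[of k] in simp)
  have elastic: "constrained_elastic q f t \<longleftrightarrow>
      (\<exists>\<xi> \<delta>. \<forall>i. (\<kappa> (i - 1) + \<kappa> (i + 1)) * (1 + z / 4 * (\<kappa> i)\<^sup>2) = \<xi> * \<kappa> i + \<delta>)"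
    unfolding constrained_elastic_def \<kappa>_def[symmetric] z_def[symmetric] divide ..
  show ?thesis unfolding elastic \<kappa>_def[symmetric]
  proof
    assume "\<exists>\<xi> \<delta>. \<forall>i. (\<kappa> (i - 1) + \<kappa> (i + 1)) * (1 + z / 4 * (\<kappa> i)\<^sup>2) = \<xi> * \<kappa> i + \<delta>"
    then obtain \<xi> \<delta> where
      *: "\<And>i. (\<kappa> (i - 1) + \<kappa> (i + 1)) * (1 + z / 4 * (\<kappa> i)\<^sup>2) = \<xi> * \<kappa> i + \<delta>" by blast
    \<comment> \<open>The value that the invariant must take for the vertex relation to reproduce
      the given \<open>\<xi>\<close>.\<close>
    define C where "C = (\<xi> - A) / z"
    have \<xi>: "\<xi> = A + C * z" using z by (simp add: C_def)
    obtain a where a: "a \<noteq> 0" "\<langle>\<langle>f 0, a\<rangle>\<rangle> = \<kappa> 0" "\<langle>\<langle>f 1, a\<rangle>\<rangle> = \<kappa> 1" "\<langle>\<langle>q, a\<rangle>\<rangle> = \<delta> / h"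
      "\<langle>\<langle>n 0, a\<rangle>\<rangle> = C - \<kappa> 0 * \<kappa> 1 / 2"
      unfolding n_def using discrete_curve_edge_solve[OF assms] by blast
    have vertex_a: "\<langle>\<langle>f (i - 1), a\<rangle>\<rangle> + \<langle>\<langle>f (i + 1), a\<rangle>\<rangle> =
        A * \<langle>\<langle>f i, a\<rangle>\<rangle> + \<delta> + \<kappa> i * z / 2 * (\<langle>\<langle>n (i - 1), a\<rangle>\<rangle> + \<langle>\<langle>n i, a\<rangle>\<rangle>)"
      "(\<kappa> (i - 1) + \<kappa> (i + 1)) * (1 + z / 4 * (\<kappa> i)\<^sup>2) = (A + C * z) * \<kappa> i + \<delta>" for i
      using sum[of i a] *[of i] h by (simp_all add: a(4) \<xi>)
    \<comment> \<open>A step needs two consecutive points and the normal of the edge between them,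
      so the invariant carries all three.\<close>
    let ?P = "\<lambda>i. \<langle>\<langle>f i, a\<rangle>\<rangle> = \<kappa> i \<and> \<langle>\<langle>f (i + 1), a\<rangle>\<rangle> = \<kappa> (i + 1) \<and>
      \<langle>\<langle>n i, a\<rangle>\<rangle> = C - \<kappa> i * \<kappa> (i + 1) / 2"
    have "?P i" for i
    proof (induction i rule: int_induct[where k = 0])
      case base
      show ?case using a by simp
    next
      case (step1 i)
      have i: "i + 1 - 1 = i" "i + 1 + 1 = i + 2" by simp_all
      have IH: "\<langle>\<langle>f i, a\<rangle>\<rangle> = \<kappa> i" "\<langle>\<langle>f (i + 1), a\<rangle>\<rangle> = \<kappa> (i + 1)"
        "\<langle>\<langle>n i, a\<rangle>\<rangle> = C - \<kappa> i * \<kappa> (i + 1) / 2" using step1 by simp_all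
      have "\<langle>\<langle>f (i + 2), a\<rangle>\<rangle> = \<kappa> (i + 2) \<and> \<langle>\<langle>n (i + 1), a\<rangle>\<rangle> = C - \<kappa> (i + 1) * \<kappa> (i + 2) / 2"
        using elastic_step[OF z vertex_a(1)[of "i + 1", unfolded i IH(1,2)]
            diff[of "i + 1" a, unfolded i IH(1)] IH(3) vertex_a(2)[of "i + 1", unfolded i]]
        by blast
      with step1 show ?case unfolding i by blast
    next
      case (step2 i)
      then have IH: "\<langle>\<langle>f i, a\<rangle>\<rangle> = \<kappa> i" "\<langle>\<langle>f (i + 1), a\<rangle>\<rangle> = \<kappa> (i + 1)"
        "\<langle>\<langle>n i, a\<rangle>\<rangle> = C - \<kappa> (i + 1) * \<kappa> i / 2" by (simp_all add: mult.commute)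
      \<comment> \<open>Going backwards, \<open>f (i - 1)\<close> and \<open>n (i - 1)\<close> are
        the unknowns; the relations at vertex \<open>i\<close> are rearranged into the mirrored form
        for \<open>elastic_step\<close>.\<close>
      have "\<kappa> (i + 1) + \<langle>\<langle>f (i - 1), a\<rangle>\<rangle> =
          A * \<kappa> i + \<delta> + \<kappa> i * z / 2 * (\<langle>\<langle>n i, a\<rangle>\<rangle> + \<langle>\<langle>n (i - 1), a\<rangle>\<rangle>)"
        using vertex_a(1)[of i, unfolded IH(1,2)] by (simp only: add.commute)
      moreover have "\<langle>\<langle>n (i - 1), a\<rangle>\<rangle> - \<langle>\<langle>n i, a\<rangle>\<rangle> = \<kappa> i / 2 * (\<kappa> (i + 1) - \<langle>\<langle>f (i - 1), a\<rangle>\<rangle>)"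
        using diff[of i a, unfolded IH(2)] by argo
      moreover have "(\<kappa> (i + 1) + \<kappa> (i - 1)) * (1 + z / 4 * (\<kappa> i)\<^sup>2) = (A + C * z) * \<kappa> i + \<delta>"
        using vertex_a(2)[of i] by (simp only: add.commute)
      ultimately have "\<langle>\<langle>f (i - 1), a\<rangle>\<rangle> = \<kappa> (i - 1) \<and> \<langle>\<langle>n (i - 1), a\<rangle>\<rangle> = C - \<kappa> i * \<kappa> (i - 1) / 2"
        using elastic_step[OF z _ _ IH(3)] by blast
      with IH(1) show ?case by (simp add: mult.commute)
    qed
    with a(1) show "\<exists>a \<omega>. a \<noteq> 0 \<and> \<omega> \<noteq> 0 \<and> (\<forall>i. \<kappa> i = \<omega> * \<langle>\<langle>f i, a\<rangle>\<rangle>)"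
      by (intro exI[of _ a] exI[of _ 1]) simp
  next
    assume "\<exists>a \<omega>. a \<noteq> 0 \<and> \<omega> \<noteq> 0 \<and> (\<forall>i. \<kappa> i = \<omega> * \<langle>\<langle>f i, a\<rangle>\<rangle>)"
    then obtain a \<omega> where "\<And>i. \<kappa> i = \<omega> * \<langle>\<langle>f i, a\<rangle>\<rangle>" by blast
    \<comment> \<open>The factor \<open>\<omega>\<close> is absorbed by taking
      \<open>b = \<omega> *\<^sub>R a\<close>.\<close>
    then obtain b where b: "\<And>i. \<langle>\<langle>f i, b\<rangle>\<rangle> = \<kappa> i"
      by (metis lie_inner_linear(6))
    define C where "C i = \<langle>\<langle>n i, b\<rangle>\<rangle> + \<kappa> i * \<kappa> (i + 1) / 2" for i
    have C_step: "C i = C (i - 1)" for i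
      using diff[of i b] by (simp add: C_def b algebra_simps)
    have "C i = C 0" for i
    proof (induction i rule: int_induct[where k = 0])
      case (step1 i)
      with C_step[of "i + 1"] show ?case by simp
    next
      case (step2 i)
      with C_step[of i] show ?case by simp
    qed simp
    then have n: "\<langle>\<langle>n i, b\<rangle>\<rangle> = C 0 - \<kappa> i * \<kappa> (i + 1) / 2" for i
      by (metis C_def add_diff_cancel_right')
    \<comment> \<open>The two normals at the vertex contribute \<open>2 * C 0 - \<kappa> i / 2 *
      (\<kappa> (i - 1) + \<kappa> (i + 1))\<close>; the second term supplies the quadratic factor
      on the left.\<close>
    have "(\<kappa> (i - 1) + \<kappa> (i + 1)) * (1 + z / 4 * (\<kappa> i)\<^sup>2) = (A + C 0 * z) * \<kappa> i + h * \<langle>\<langle>q, b\<rangle>\<rangle>" for i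
      using sum[of i b] by (simp add: b n power2_eq_square algebra_simps add_divide_distrib)
    then show "\<exists>\<xi> \<delta>. \<forall>i. (\<kappa> (i - 1) + \<kappa> (i + 1)) * (1 + z / 4 * (\<kappa> i)\<^sup>2) = \<xi> * \<kappa> i + \<delta>"
      by blast
  qed
qed

end
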